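(* Let $P=(p_{ij})\in[0,1]^{N\times N}$ be the routing matrix of a Supply Chain Network, with spectral radius $\rho(P)<1$. Suppose demands propagate in ordering rounds according to $$D(s)=P\,D(s-1)+D_{\mathrm{ext}}(s),$$ where the $\mathbb R^N$-valued external demand shocks $D_{\mathrm{ext}}(s)$ are i.i.d. with covariance matrix $\Sigma_D$, and $D_{\mathrm{ext}}(s)$ is independent of the preceding state $D(s-1)$. Let $\Sigma=(\sigma_{ij})$ be the stationary covariance matrix of the node demands, i.e. $\Sigma=\operatorname{Cov}(D(s))=\operatorname{Cov}(D(s-1))$. Then: (1) $\Sigma$ satisfies the discrete-time Lyapunov equation $$\Sigma=P\Sigma P^{\top}+\Sigma_D .$$ (2) If, in addition, $\Sigma_D=\operatorname{diag}(w_1^2,\dots,w_N^2)$ is diagonal and the demand deviations feeding any given node are uncorrelated, i.e. for every $i$ and all $j\neq k$ with $p_{ij}>0$ and $p_{ik}>0$ one has $\sigma_{jk}=0$, then the node variances are given by $$(\sigma^2)^{\top}=M_\sigma\,(w^2)^{\top},\qquad M_\sigma:=\left(I-(P\odot P)\right)^{-1},$$ where $\sigma^2=(\sigma_1^2,\dots,\sigma_N^2)$ with $\sigma_i^2:=\sigma_{ii}$, and $w^2=(w_1^2,\dots,w_N^2)$.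
   Context: A Supply Chain Network has nodes $1,\dots,N$; the entry $p_{ij}\in[0,1]$ of the routing matrix $P$ is the proportion of the demand of node $j$ produced by node $i$, so that the demand of node $i$ aggregates the terms $p_{ij}D_j$ over $j$ plus external demand. All random vectors have finite second moments. $P\odot P$ denotes the element-wise (Hadamard) product, with entries $p_{ij}^2$. $M_\sigma$ is called the variance multiplier matrix. *)

theory Defs
  imports "HOL-Probability.Probability"
begin

text \<open>The eigenvalues of a real matrix are taken over the complex numbers, so the set below
  is finite and nonempty and \<open>Max\<close> is meaningful.\<close>

definition complex_spectrum :: "real ^ 'n ^ 'n \<Rightarrow> complex set" where
  "complex_spectrum A =
     {k. \<exists>v :: complex ^ 'n. v \<noteq> 0 \<and> map_matrix complex_of_real A *v v = k *s v}"

definition matrix_spectral_radius :: "real ^ 'n ^ 'n \<Rightarrow> real" where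
  "matrix_spectral_radius A = Max (cmod ` complex_spectrum A)"

definition hadamard :: "real ^ 'n ^ 'm \<Rightarrow> real ^ 'n ^ 'm \<Rightarrow> real ^ 'n ^ 'm" where
  "hadamard A B = (\<chi> i j. A $ i $ j * B $ i $ j)"

definition diag_matrix :: "real ^ 'n \<Rightarrow> real ^ 'n ^ 'n" where
  "diag_matrix d = (\<chi> i j. if i = j then d $ i else 0)"

text \<open>The Bochner integral of a non-integrable function is \<open>0\<close>, so \<open>covariance_matrix\<close> is only
  used together with \<open>finite_second_moments\<close>.\<close>

definition finite_second_moments :: "'a measure \<Rightarrow> ('a \<Rightarrow> real ^ 'n) \<Rightarrow> bool" where
  "finite_second_moments M X \<longleftrightarrow>
     X \<in> borel_measurable M \<and> (\<forall>i. integrable M (\<lambda>\<omega>. (X \<omega> $ i)\<^sup>2))"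

definition covariance_matrix :: "'a measure \<Rightarrow> ('a \<Rightarrow> real ^ 'n) \<Rightarrow> real ^ 'n ^ 'n" where
  "covariance_matrix M X =
     (\<chi> i j. \<integral>\<omega>. (X \<omega> $ i - (\<integral>\<eta>. X \<eta> $ i \<partial>M)) * (X \<omega> $ j - (\<integral>\<eta>. X \<eta> $ j \<partial>M)) \<partial>M)"

text \<open>\<open>matrix_inv\<close> is unspecified on singular matrices; invertibility of
  \<open>I - P \<odot> P\<close> has to be established separately.\<close>

definition variance_multiplier :: "real ^ 'n ^ 'n \<Rightarrow> real ^ 'n ^ 'n" where
  "variance_multiplier P = matrix_inv (mat 1 - hadamard P P)"

end

theory Submission
  imports Defs
begin

text \<open>
  The Lyapunov equation comes from one round of the recursion. Centre all vectors at their means;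
  then \<open>\<Sigma>\<close> is the expectation of the outer product of \<open>P Y + Z\<close> with itself, where \<open>Y\<close> is the
  centred previous state and \<open>Z\<close> the centred shock. The mixed terms vanish because \<open>Y\<close> and \<open>Z\<close> are
  independent with mean zero, so only the two quadratic terms \<open>P \<Sigma> P\<^sup>T\<close> and \<open>\<Sigma>\<^sub>D\<close> remain
  (\<open>covariance_matrix_affine_indep\<close>).

  For the variances, read off the diagonal of this equation: when the demands feeding node \<open>i\<close> are
  uncorrelated, the quadratic form \<open>(P \<Sigma> P\<^sup>T)\<^sub>i\<^sub>i\<close> loses all its off-diagonal terms and becomes
  \<open>\<Sum>\<^sub>j p\<^sub>i\<^sub>j\<^sup>2 \<sigma>\<^sub>j\<^sup>2\<close> (\<open>diagonal_congruence_of_uncorrelated\<close>). This is the linear system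
  \<open>(I - P \<odot> P) \<sigma>\<^sup>2 = w\<^sup>2\<close>.

  The system is uniquely solvable (\<open>invertible_one_minus_hadamard_square\<close>) by an argument of
  Perron-Frobenius type. Since \<open>p\<^sup>2 \<le> p\<close> on the unit interval, a kernel vector \<open>v\<close> of \<open>I - P \<odot> P\<close>
  gives a nonnegative vector \<open>u = \<bar>v\<bar>\<close> with \<open>u \<le> P u\<close>. Were \<open>u\<close> nonzero, Brouwer's fixed point
  theorem would produce an eigenvector of \<open>P\<close> among the vectors with this property, and its
  eigenvalue would be at least \<open>1\<close> (\<open>nonneg_matrix_eigenvector_above\<close>), against \<open>\<rho>(P) < 1\<close>.
\<close>

section \<open>Eigenvalues and the spectral radius\<close>

lemma norm_vector_scalar_mult: "norm (k *s v) = cmod k * norm (v :: complex ^ 'n)"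
  by (simp add: norm_vec_def norm_mult L2_set_right_distrib)

text \<open>
  The eigenvalues are the roots of \<open>det (A - k I)\<close>, which is a polynomial in \<open>k\<close>: it is the determinant
  of a matrix over the polynomial ring. That polynomial is not zero since eigenvalues are bounded by
  the operator norm of \<open>A\<close>.
\<close>

lemma finite_eigenvalues:
  fixes A :: "complex ^ 'n ^ 'n"
  shows "finite {k. \<exists>v. v \<noteq> 0 \<and> A *v v = k *s v}" (is "finite ?S")
proof -
  \<comment> \<open>the matrix \<open>A - X I\<close> with polynomial entries\<close>
  define B :: "complex poly ^ 'n ^ 'n" where
    "B = (\<chi> i j. [:A $ i $ j, if i = j then - 1 else 0:])"
  define q where "q = det B"
  have poly_q: "poly q k = det (A - mat k)" for k
    unfolding q_def det_def poly_sum poly_mult poly_prod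
    by (intro sum.cong arg_cong2[of _ _ _ _ "(*)"] prod.cong)
       (auto simp: B_def mat_def sign_def)
  have root: "poly q k = 0 \<longleftrightarrow> k \<in> ?S" for k
  proof -
    have "poly q k = 0 \<longleftrightarrow> \<not> invertible (A - mat k)"
      by (simp add: poly_q invertible_det_nz)
    also have "\<dots> \<longleftrightarrow> (\<exists>v. (A - mat k) *v v = 0 \<and> v \<noteq> 0)"
      by (auto simp: invertible_left_inverse matrix_left_invertible_ker)
    also have "\<dots> \<longleftrightarrow> k \<in> ?S"
    proof -
      have "mat k *v v = k *s v" for v :: "complex ^ 'n"
        by (simp add: vec_eq_iff matrix_vector_mult_def mat_def if_distrib if_distribR cong: if_cong)
      thus ?thesis by (auto simp: matrix_vector_mult_diff_rdistrib)
    qed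
    finally show ?thesis .
  qed
  have bound: "cmod k \<le> onorm ((*v) A)" if "k \<in> ?S" for k
  proof -
    from that obtain v where v: "v \<noteq> 0" "A *v v = k *s v" by (elim CollectE exE conjE)
    have "cmod k * norm v = norm (A *v v)"
      by (simp only: v(2) norm_vector_scalar_mult)
    also have "\<dots> \<le> onorm ((*v) A) * norm v"
      by (rule onorm[OF matrix_vector_mul_bounded_linear])
    finally show ?thesis using v(1) by (meson mult_right_le_imp_le zero_less_norm_iff)
  qed
  define r where "r = \<bar>onorm ((*v) A)\<bar> + 1"
  have "complex_of_real r \<notin> ?S"
  proof
    assume "complex_of_real r \<in> ?S"
    from bound[OF this] have "\<bar>r\<bar> \<le> onorm ((*v) A)" by (simp only: norm_of_real)
    thus False by (simp add: r_def)
  qed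
  hence "poly q (complex_of_real r) \<noteq> 0" by (simp only: root not_False_eq_True)
  hence "q \<noteq> 0" by force
  hence "finite {k. poly q k = 0}" by (rule poly_roots_finite)
  thus ?thesis by (simp only: root Collect_mem_eq)
qed

text \<open>\<open>Max\<close> bounds the members of a finite set only, hence the need for \<open>finite_eigenvalues\<close>.\<close>

lemma cmod_eigenvalue_le_spectral_radius:
  assumes "k \<in> complex_spectrum A"
  shows "cmod k \<le> matrix_spectral_radius A"
proof -
  have "finite (complex_spectrum A)"
    unfolding complex_spectrum_def by (rule finite_eigenvalues)
  thus ?thesis
    unfolding matrix_spectral_radius_def
    by (rule Max_ge[OF finite_imageI imageI[OF assms]])
qed

lemma real_eigenvalue_in_complex_spectrum:
  fixes A :: "real ^ 'n ^ 'n"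
  assumes "x \<noteq> 0" "A *v x = l *s x"
  shows "complex_of_real l \<in> complex_spectrum A"
proof -
  define z :: "complex ^ 'n" where "z = (\<chi> i. complex_of_real (x $ i))"
  have "map_matrix complex_of_real A *v z = (\<chi> i. complex_of_real ((A *v x) $ i))"
    by (simp add: z_def vec_eq_iff) (simp add: matrix_vector_mult_def)
  also have "\<dots> = complex_of_real l *s z"
    by (simp add: assms(2) z_def vec_eq_iff)
  finally have "map_matrix complex_of_real A *v z = complex_of_real l *s z" .
  moreover have "z \<noteq> 0" using assms(1) by (auto simp: z_def vec_eq_iff)
  ultimately show ?thesis unfolding complex_spectrum_def by blast
qed

section \<open>Nonnegative matrices and the solvability of the variance system\<close>

text \<open>
  The nonnegative vectors \<open>x\<close> with \<open>x \<le> A x\<close> and coordinate sum \<open>1\<close> form a compact convex set.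
  Monotonicity of \<open>A\<close> shows that applying \<open>A\<close> and rescaling to sum \<open>1\<close> maps this set to itself, so
  Brouwer's theorem applies. At a fixed point the rescaling factor is an eigenvalue, and it is at
  least \<open>1\<close> because \<open>A x\<close> dominates \<open>x\<close>.
\<close>

lemma nonneg_matrix_eigenvector_above:
  fixes A :: "real ^ 'n ^ 'n"
  assumes nonneg: "\<And>i j. 0 \<le> A $ i $ j"
    and u: "u \<noteq> 0" "\<And>i. 0 \<le> u $ i" "\<And>i. u $ i \<le> (A *v u) $ i"
  obtains x l where "x \<noteq> 0" "1 \<le> l" "A *v x = l *s x"
proof -
  define t :: "real ^ 'n \<Rightarrow> real" where "t x = (\<Sum>i\<in>UNIV. x $ i)" for x
  define K where "K = {x. (\<forall>i. 0 \<le> x $ i) \<and> t x = 1 \<and> (\<forall>i. x $ i \<le> (A *v x) $ i)}"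
  have t_scale: "t (c *\<^sub>R x) = c * t x" for c x
    by (simp add: t_def sum_distrib_left)
  have t_add: "t (x + y) = t x + t y" for x y
    by (simp add: t_def sum.distrib)
  have cont_t: "continuous_on S t" for S
    unfolding t_def by (intro continuous_intros)
  have cont_A: "continuous_on S ((*v) A)" for S
    by (rule linear_continuous_on) simp
  have A_mono: "(A *v x) $ i \<le> (A *v y) $ i" if "\<And>i. x $ i \<le> y $ i" for x y i
    unfolding matrix_vector_mult_def using that nonneg by (auto intro!: sum_mono mult_left_mono)
  have t_ge1: "1 \<le> t (A *v x)" if "x \<in> K" for x
  proof -
    have "t x \<le> t (A *v x)" unfolding t_def using that by (intro sum_mono) (simp add: K_def)
    thus ?thesis using that by (simp add: K_def)
  qed
  have convex: "convex K"
    unfolding convex_def K_def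
    by (auto simp: t_add t_scale matrix_vector_right_distrib matrix_vector_mult_scaleR
             intro!: add_mono mult_left_mono)
  have closed: "closed K"
    unfolding K_def
    by (intro closed_Collect_conj closed_Collect_all closed_Collect_le closed_Collect_eq
          continuous_intros cont_t cont_A)
  have bounded: "bounded K"
  proof (rule boundedI)
    fix x assume "x \<in> K"
    hence "(\<Sum>i\<in>UNIV. \<bar>x $ i\<bar>) = 1" by (simp add: K_def t_def)
    thus "norm x \<le> 1" using norm_le_l1_cart[of x] by simp
  qed
  have t_u: "0 < t u"
  proof -
    obtain i where "u $ i \<noteq> 0" using u(1) by (auto simp: vec_eq_iff)
    thus ?thesis unfolding t_def using u(2)
      by (intro sum_pos2[of _ i]) (auto simp: less_le)
  qed
  have "(1 / t u) *\<^sub>R u \<in> K"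
    using t_u u by (auto simp: K_def t_scale matrix_vector_mult_scaleR intro!: divide_right_mono)
  hence nonempty: "K \<noteq> {}" by blast
  define f where "f x = (1 / t (A *v x)) *\<^sub>R (A *v x)" for x
  have "t (A *v x) \<noteq> 0" if "x \<in> K" for x using t_ge1[OF that] by simp
  hence cont: "continuous_on K f"
    unfolding f_def
    by (intro continuous_intros continuous_on_compose2[OF cont_t[of UNIV]] cont_A) auto
  have maps: "f \<in> K \<rightarrow> K"
  proof
    fix x assume x: "x \<in> K"
    have pos: "0 < t (A *v x)" using t_ge1[OF x] by simp
    have "x $ i \<le> (A *v x) $ i" "0 \<le> x $ i" for i using x by (auto simp: K_def)
    hence "(A *v x) $ i \<le> (A *v (A *v x)) $ i" "0 \<le> (A *v x) $ i" for i
      by (blast intro: A_mono, meson order_trans)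
    thus "f x \<in> K"
      using pos by (auto simp: K_def f_def t_scale matrix_vector_mult_scaleR intro!: divide_right_mono)
  qed
  obtain x where x: "x \<in> K" "f x = x"
    using brouwer[OF _ convex nonempty cont maps] closed bounded
    by (auto simp: compact_eq_bounded_closed)
  show thesis
  proof
    show "x \<noteq> 0" using x(1) by (auto simp: K_def t_def)
    show "1 \<le> t (A *v x)" by (rule t_ge1[OF x(1)])
    have "t (A *v x) *\<^sub>R f x = A *v x" using t_ge1[OF x(1)] by (simp add: f_def)
    thus "A *v x = t (A *v x) *s x" by (simp add: x(2) scalar_mult_eq_scaleR)
  qed
qed

text \<open>
  This is the form in which \<open>\<rho>(A) < 1\<close> enters the solvability proof. It stands in for the
  convergence \<open>A\<^sup>n \<rightarrow> 0\<close>, from which \<open>u \<le> A\<^sup>n u\<close> would give the same conclusion.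
\<close>

lemma superinvariant_vector_eq_0:
  fixes A :: "real ^ 'n ^ 'n"
  assumes "\<And>i j. 0 \<le> A $ i $ j" "matrix_spectral_radius A < 1"
    and "\<And>i. 0 \<le> u $ i" "\<And>i. u $ i \<le> (A *v u) $ i"
  shows "u = 0"
proof (rule ccontr)
  assume "u \<noteq> 0"
  then obtain x l where x: "x \<noteq> 0" "1 \<le> l" "A *v x = l *s x"
    using nonneg_matrix_eigenvector_above[OF assms(1) _ assms(3,4)] by blast
  have "cmod (complex_of_real l) \<le> matrix_spectral_radius A"
    by (intro cmod_eigenvalue_le_spectral_radius real_eigenvalue_in_complex_spectrum[OF x(1,3)])
  thus False using x(2) assms(2) by simp
qed

lemma invertible_one_minus_hadamard_square:
  fixes P :: "real ^ 'n ^ 'n"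
  assumes P: "\<And>i j. 0 \<le> P $ i $ j \<and> P $ i $ j \<le> 1" and radius: "matrix_spectral_radius P < 1"
  shows "invertible (mat 1 - hadamard P P)"
proof -
  have "v = 0" if "(mat 1 - hadamard P P) *v v = 0" for v
  proof -
    define u where "u = (\<chi> i. \<bar>v $ i\<bar>)"
    have v: "v $ i = (\<Sum>j\<in>UNIV. P $ i $ j * P $ i $ j * v $ j)" for i
    proof -
      have "hadamard P P *v v = v"
        using that by (simp add: matrix_vector_mult_diff_rdistrib)
      hence "v $ i = (hadamard P P *v v) $ i" by simp
      thus ?thesis by (simp add: hadamard_def matrix_vector_mult_def)
    qed
    have "\<bar>v $ i\<bar> \<le> (P *v u) $ i" for i
    proof -
      have "\<bar>v $ i\<bar> \<le> (\<Sum>j\<in>UNIV. \<bar>P $ i $ j * P $ i $ j * v $ j\<bar>)"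
        by (subst v) (rule sum_abs)
      \<comment> \<open>\<open>p\<^sup>2 \<le> p\<close> for entries in the unit interval\<close>
      also have "\<dots> \<le> (\<Sum>j\<in>UNIV. P $ i $ j * \<bar>v $ j\<bar>)"
        using P by (intro sum_mono) (auto simp: abs_mult intro!: mult_right_mono mult_left_le)
      finally show ?thesis by (simp add: u_def matrix_vector_mult_def)
    qed
    hence "u = 0"
      using superinvariant_vector_eq_0[of P u] P radius by (simp add: u_def)
    thus ?thesis by (simp add: u_def vec_eq_iff)
  qed
  thus ?thesis by (auto simp: invertible_left_inverse matrix_left_invertible_ker)
qed

lemma matrix_inv_left_inverse:
  fixes A :: "'a :: field ^ 'n ^ 'n"
  assumes "invertible A"
  shows "matrix_inv A ** A = mat 1"
  using assms unfolding invertible_def matrix_inv_def by (rule someI2_ex) blast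

section \<open>Covariance of one round of the recursion\<close>

lemma borel_measurable_vec_nth [measurable (raw)]:
  fixes X :: "'a \<Rightarrow> real ^ 'n"
  assumes "X \<in> borel_measurable M"
  shows "(\<lambda>\<omega>. X \<omega> $ i) \<in> borel_measurable M"
  by (rule borel_measurable_continuous_on[OF _ assms]) (intro continuous_intros)

lemma finite_second_momentsD:
  assumes "finite_second_moments M X"
  shows "X \<in> borel_measurable M" "integrable M (\<lambda>\<omega>. (X \<omega> $ i)\<^sup>2)"
  using assms by (auto simp: finite_second_moments_def)

lemma integrable_mult_of_squares:
  fixes f g :: "'a \<Rightarrow> real"
  assumes [measurable]: "f \<in> borel_measurable M" "g \<in> borel_measurable M"
    and "integrable M (\<lambda>\<omega>. (f \<omega>)\<^sup>2)" "integrable M (\<lambda>\<omega>. (g \<omega>)\<^sup>2)"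
  shows "integrable M (\<lambda>\<omega>. f \<omega> * g \<omega>)"
proof (rule Bochner_Integration.integrable_bound)
  show "integrable M (\<lambda>\<omega>. (f \<omega>)\<^sup>2 + (g \<omega>)\<^sup>2)" using assms by simp
  have "\<bar>a * b\<bar> \<le> a\<^sup>2 + b\<^sup>2" for a b :: real
  proof -
    have "2 * \<bar>a * b\<bar> \<le> a\<^sup>2 + b\<^sup>2"
      using sum_squares_bound[of "\<bar>a\<bar>" "\<bar>b\<bar>"] by (simp add: abs_mult)
    thus ?thesis by linarith
  qed
  thus "AE \<omega> in M. norm (f \<omega> * g \<omega>) \<le> norm ((f \<omega>)\<^sup>2 + (g \<omega>)\<^sup>2)" by simp
qed simp

lemma (in prob_space) integrable_component:
  assumes "finite_second_moments M X"
  shows "integrable M (\<lambda>\<omega>. X \<omega> $ i)"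
proof -
  note [measurable] = finite_second_momentsD(1)[OF assms]
  show ?thesis
    by (rule square_integrable_imp_integrable[OF _ finite_second_momentsD(2)[OF assms]]) measurable
qed

lemma covariance_matrix_cong_AE:
  assumes [measurable]: "X \<in> borel_measurable M" "Y \<in> borel_measurable M"
    and "AE \<omega> in M. X \<omega> = Y \<omega>"
  shows "covariance_matrix M X = covariance_matrix M Y"
proof -
  have mean: "(\<integral>\<omega>. X \<omega> $ i \<partial>M) = (\<integral>\<omega>. Y \<omega> $ i \<partial>M)" for i
    using assms(3) by (intro integral_cong_AE) auto
  show ?thesis
    unfolding covariance_matrix_def vec_eq_iff vec_lambda_beta mean
    using assms(3) by (intro allI integral_cong_AE) auto
qed

text \<open>
  Centring turns this into a computation with second moments of mean-zero variables, in which the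
  mixed terms factor by independence and hence vanish.
\<close>

lemma (in prob_space) covariance_matrix_affine_indep:
  fixes A :: "real ^ 'n ^ 'n"
  assumes X: "finite_second_moments M X" and E: "finite_second_moments M E"
    and indep: "indep_var borel E borel X"
  shows "covariance_matrix M (\<lambda>\<omega>. A *v X \<omega> + E \<omega>) =
    A ** covariance_matrix M X ** transpose A + covariance_matrix M E"
proof -
  note [measurable] = finite_second_momentsD(1)[OF X] finite_second_momentsD(1)[OF E]
  note int [simp] = integrable_component[OF X] integrable_component[OF E]
  define Y where "Y j \<omega> = X \<omega> $ j - expectation (\<lambda>\<eta>. X \<eta> $ j)" for j \<omega>
  define Z where "Z j \<omega> = E \<omega> $ j - expectation (\<lambda>\<eta>. E \<eta> $ j)" for j \<omega>
  have Y [measurable]: "Y j \<in> borel_measurable M" for j unfolding Y_def by measurable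
  have Z [measurable]: "Z j \<in> borel_measurable M" for j unfolding Z_def by measurable
  have sq: "integrable M (\<lambda>\<omega>. (Y j \<omega>)\<^sup>2)" "integrable M (\<lambda>\<omega>. (Z j \<omega>)\<^sup>2)" for j
    unfolding Y_def Z_def power2_diff
    using finite_second_momentsD(2)[OF X] finite_second_momentsD(2)[OF E] by auto
  have prod_int [simp]: "integrable M (\<lambda>\<omega>. Y j \<omega> * Y l \<omega>)" "integrable M (\<lambda>\<omega>. Z j \<omega> * Z l \<omega>)"
    "integrable M (\<lambda>\<omega>. Y j \<omega> * Z l \<omega>)" "integrable M (\<lambda>\<omega>. Z l \<omega> * Y j \<omega>)" for j l
    by (intro integrable_mult_of_squares Y Z sq)+
  have YZ: "expectation (\<lambda>\<omega>. Z l \<omega> * Y j \<omega>) = 0" for j l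
  proof -
    have "indep_var borel (Z l) borel (Y j)"
      using indep_var_compose[OF indep, of "\<lambda>x. x $ l - expectation (\<lambda>\<eta>. E \<eta> $ l)" borel
          "\<lambda>x. x $ j - expectation (\<lambda>\<eta>. X \<eta> $ j)" borel]
      by (simp add: o_def Y_def[abs_def] Z_def[abs_def])
    hence "expectation (\<lambda>\<omega>. Z l \<omega> * Y j \<omega>) = expectation (Z l) * expectation (Y j)"
      by (rule indep_var_lebesgue_integral) (simp_all add: Y_def[abs_def] Z_def[abs_def])
    also have "expectation (Y j) = 0" by (simp add: Y_def[abs_def] prob_space)
    finally show ?thesis by simp
  qed
  have centred: "(A *v X \<omega> + E \<omega>) $ i - expectation (\<lambda>\<eta>. (A *v X \<eta> + E \<eta>) $ i) =
      (\<Sum>j\<in>UNIV. A $ i $ j * Y j \<omega>) + Z i \<omega>" for i \<omega>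
    by (simp add: matrix_vector_mult_def Y_def Z_def right_diff_distrib sum_subtractf)
  have "expectation (\<lambda>\<omega>. ((\<Sum>j\<in>UNIV. A $ i $ j * Y j \<omega>) + Z i \<omega>) *
        ((\<Sum>l\<in>UNIV. A $ k $ l * Y l \<omega>) + Z k \<omega>)) =
      (\<Sum>l\<in>UNIV. (\<Sum>j\<in>UNIV. A $ i $ j * expectation (\<lambda>\<omega>. Y j \<omega> * Y l \<omega>)) * A $ k $ l) +
      expectation (\<lambda>\<omega>. Z i \<omega> * Z k \<omega>)" (is "?L = ?R") for i k
  proof -
    have "?L = expectation (\<lambda>\<omega>.
        (\<Sum>l\<in>UNIV. \<Sum>j\<in>UNIV. A $ i $ j * A $ k $ l * (Y j \<omega> * Y l \<omega>)) +
        (\<Sum>j\<in>UNIV. A $ i $ j * (Z k \<omega> * Y j \<omega>)) +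
        (\<Sum>l\<in>UNIV. A $ k $ l * (Z i \<omega> * Y l \<omega>)) + Z i \<omega> * Z k \<omega>)"
    proof (rule Bochner_Integration.integral_cong[OF refl])
      fix \<omega>
      have "(\<Sum>j\<in>UNIV. A $ i $ j * Y j \<omega>) * (\<Sum>l\<in>UNIV. A $ k $ l * Y l \<omega>) =
          (\<Sum>l\<in>UNIV. \<Sum>j\<in>UNIV. A $ i $ j * A $ k $ l * (Y j \<omega> * Y l \<omega>))"
        by (subst sum.swap) (simp add: sum_product ac_simps)
      moreover have "(\<Sum>j\<in>UNIV. A $ i $ j * Y j \<omega>) * Z k \<omega> = (\<Sum>j\<in>UNIV. A $ i $ j * (Z k \<omega> * Y j \<omega>))"
        "Z i \<omega> * (\<Sum>l\<in>UNIV. A $ k $ l * Y l \<omega>) = (\<Sum>l\<in>UNIV. A $ k $ l * (Z i \<omega> * Y l \<omega>))"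
        by (simp_all add: sum_distrib_left sum_distrib_right ac_simps)
      ultimately show "((\<Sum>j\<in>UNIV. A $ i $ j * Y j \<omega>) + Z i \<omega>) *
          ((\<Sum>l\<in>UNIV. A $ k $ l * Y l \<omega>) + Z k \<omega>) =
          (\<Sum>l\<in>UNIV. \<Sum>j\<in>UNIV. A $ i $ j * A $ k $ l * (Y j \<omega> * Y l \<omega>)) +
          (\<Sum>j\<in>UNIV. A $ i $ j * (Z k \<omega> * Y j \<omega>)) +
          (\<Sum>l\<in>UNIV. A $ k $ l * (Z i \<omega> * Y l \<omega>)) + Z i \<omega> * Z k \<omega>"
        by (simp add: distrib_left distrib_right)
    qed
    also have "\<dots> = (\<Sum>l\<in>UNIV. \<Sum>j\<in>UNIV. A $ i $ j * A $ k $ l * expectation (\<lambda>\<omega>. Y j \<omega> * Y l \<omega>)) +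
        expectation (\<lambda>\<omega>. Z i \<omega> * Z k \<omega>)"
      by (simp add: YZ)
    also have "\<dots> = ?R"
      by (simp add: sum_distrib_left sum_distrib_right mult_ac)
    finally show ?thesis .
  qed
  thus ?thesis
    unfolding covariance_matrix_def vec_eq_iff vec_lambda_beta centred
    by (simp add: matrix_matrix_mult_def transpose_def Y_def Z_def)
qed

section \<open>The Lyapunov equation and the node variances\<close>

text \<open>
  In the double sum \<open>\<Sum>\<^sub>j\<^sub>k p\<^sub>i\<^sub>j S\<^sub>j\<^sub>k p\<^sub>i\<^sub>k\<close> each term with \<open>j \<noteq> k\<close> has a vanishing factor: either one of
  the weights is zero, or both are positive and \<open>S\<^sub>j\<^sub>k = 0\<close>.
\<close>

lemma diagonal_congruence_of_uncorrelated:
  fixes P S :: "real ^ 'n ^ 'n"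
  assumes nonneg: "\<And>i j. 0 \<le> P $ i $ j"
    and uncorrelated: "\<And>i j k. j \<noteq> k \<Longrightarrow> P $ i $ j > 0 \<Longrightarrow> P $ i $ k > 0 \<Longrightarrow> S $ j $ k = 0"
  shows "(P ** S ** transpose P) $ i $ i = (hadamard P P *v (\<chi> i. S $ i $ i)) $ i"
proof -
  have "(P ** S ** transpose P) $ i $ i =
      (\<Sum>k\<in>UNIV. \<Sum>j\<in>UNIV. P $ i $ j * S $ j $ k * P $ i $ k)"
    by (simp add: matrix_matrix_mult_def transpose_def sum_distrib_right)
  also have "\<dots> = (\<Sum>k\<in>UNIV. \<Sum>j\<in>UNIV. if j = k then P $ i $ j * S $ j $ k * P $ i $ k else 0)"
  proof (intro sum.cong refl)
    fix j k
    have "P $ i $ j * S $ j $ k * P $ i $ k = 0" if "j \<noteq> k"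
      using uncorrelated[OF that, of i] nonneg[of i j] nonneg[of i k] by (auto simp: less_le)
    thus "P $ i $ j * S $ j $ k * P $ i $ k =
        (if j = k then P $ i $ j * S $ j $ k * P $ i $ k else 0)" by simp
  qed
  also have "\<dots> = (hadamard P P *v (\<chi> i. S $ i $ i)) $ i"
    by (simp add: hadamard_def matrix_vector_mult_def ac_simps)
  finally show ?thesis .
qed

theorem theorem3:
  fixes M :: "'a measure"
    and P \<Sigma> \<Sigma>\<^sub>D :: "real ^ 'n ^ 'n"
    and D D_ext :: "nat \<Rightarrow> 'a \<Rightarrow> real ^ 'n"
  assumes prob: "prob_space M"
    and routing: "\<And>i j. 0 \<le> P $ i $ j \<and> P $ i $ j \<le> 1"
    and radius: "matrix_spectral_radius P < 1"
    and moments_D: "\<And>s. finite_second_moments M (D s)"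
    and moments_ext: "\<And>s. s \<ge> 1 \<Longrightarrow> finite_second_moments M (D_ext s)"
    and ext_indep: "prob_space.indep_vars M (\<lambda>_. borel) D_ext {1..}"
    and ext_ident: "\<And>s t. s \<ge> 1 \<Longrightarrow> t \<ge> 1 \<Longrightarrow> distr M borel (D_ext s) = distr M borel (D_ext t)"
    and ext_cov: "\<And>s. s \<ge> 1 \<Longrightarrow> covariance_matrix M (D_ext s) = \<Sigma>\<^sub>D"
    and indep_state: "\<And>s. s \<ge> 1 \<Longrightarrow> prob_space.indep_var M borel (D_ext s) borel (D (s - 1))"
    and recursion: "\<And>s. s \<ge> 1 \<Longrightarrow> (AE \<omega> in M. D s \<omega> = P *v D (s - 1) \<omega> + D_ext s \<omega>)"
    and stationary: "\<And>s. covariance_matrix M (D s) = \<Sigma>"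
  shows "\<Sigma> = P ** \<Sigma> ** transpose P + \<Sigma>\<^sub>D
    \<and> (\<forall>w :: real ^ 'n.
         \<Sigma>\<^sub>D = diag_matrix (\<chi> i. (w $ i)\<^sup>2) \<longrightarrow>
         (\<forall>i j k. j \<noteq> k \<longrightarrow> P $ i $ j > 0 \<longrightarrow> P $ i $ k > 0 \<longrightarrow> \<Sigma> $ j $ k = 0) \<longrightarrow>
         invertible (mat 1 - hadamard P P) \<and>
         (\<chi> i. \<Sigma> $ i $ i) = variance_multiplier P *v (\<chi> i. (w $ i)\<^sup>2))"
proof -
  interpret prob_space M by (rule prob)
  note [measurable] = finite_second_momentsD(1)[OF moments_D] finite_second_momentsD(1)[OF moments_ext]
  have "\<Sigma> = covariance_matrix M (D 1)" by (simp add: stationary)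
  also have "\<dots> = covariance_matrix M (\<lambda>\<omega>. P *v D 0 \<omega> + D_ext 1 \<omega>)"
  proof (rule covariance_matrix_cong_AE)
    have "(\<lambda>\<omega>. P *v D 0 \<omega>) \<in> borel_measurable M"
      by (rule borel_measurable_continuous_on[of "(*v) P"]) (auto intro: linear_continuous_on)
    thus "(\<lambda>\<omega>. P *v D 0 \<omega> + D_ext 1 \<omega>) \<in> borel_measurable M" by measurable
  qed (use recursion[of 1] in auto)
  also have "\<dots> = P ** \<Sigma> ** transpose P + \<Sigma>\<^sub>D"
    using covariance_matrix_affine_indep[OF moments_D moments_ext, of 1 0 P] indep_state[of 1]
    by (simp add: stationary ext_cov)
  finally have lyapunov: "\<Sigma> = P ** \<Sigma> ** transpose P + \<Sigma>\<^sub>D" .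
  have inv: "invertible (mat 1 - hadamard P P)"
    by (rule invertible_one_minus_hadamard_square[OF routing radius])
  have "(\<chi> i. \<Sigma> $ i $ i) = variance_multiplier P *v (\<chi> i. (w $ i)\<^sup>2)"
    if diag: "\<Sigma>\<^sub>D = diag_matrix (\<chi> i. (w $ i)\<^sup>2)"
      and uncorrelated: "\<forall>i j k. j \<noteq> k \<longrightarrow> P $ i $ j > 0 \<longrightarrow> P $ i $ k > 0 \<longrightarrow> \<Sigma> $ j $ k = 0"
    for w :: "real ^ 'n"
  proof -
    define \<sigma> where "\<sigma> = (\<chi> i. \<Sigma> $ i $ i)"
    have "\<sigma> $ i = (hadamard P P *v \<sigma>) $ i + (w $ i)\<^sup>2" for i
    proof -
      have "\<sigma> $ i = (P ** \<Sigma> ** transpose P + \<Sigma>\<^sub>D) $ i $ i"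
        using lyapunov by (simp add: \<sigma>_def)
      also have "\<dots> = (hadamard P P *v \<sigma>) $ i + (w $ i)\<^sup>2"
        using diagonal_congruence_of_uncorrelated[of P \<Sigma> i] routing uncorrelated
        by (simp add: \<sigma>_def diag diag_matrix_def)
      finally show ?thesis .
    qed
    hence "(mat 1 - hadamard P P) *v \<sigma> = (\<chi> i. (w $ i)\<^sup>2)"
      by (simp add: vec_eq_iff matrix_vector_mult_diff_rdistrib)
    hence "variance_multiplier P *v (\<chi> i. (w $ i)\<^sup>2) =
        (matrix_inv (mat 1 - hadamard P P) ** (mat 1 - hadamard P P)) *v \<sigma>"
      by (simp add: variance_multiplier_def flip: matrix_vector_mul_assoc)
    also have "\<dots> = \<sigma>" by (simp add: matrix_inv_left_inverse[OF inv])
    finally show ?thesis by (simp add: \<sigma>_def)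
  qed
  thus ?thesis using lyapunov inv by blast
qed

end
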